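(* Consider the problem of minimizing $F=f+\psi$ with $f$ and $\psi$ convex, where $f$ satisfies the blockwise Lipschitz condition with constants $L_1,\dots,L_N>0$, and consider the inexact randomized block-coordinate descent algorithm with unit step size (Algorithm B) described in the context, with $\eta\in[0,1)$. Let $L_{\max}:=\max_iL_i$, $L_{\min}:=\min_iL_i$, $L_{\mathrm{avg}}:=\frac1N\sum_{i=1}^NL_i$. Suppose $F$ satisfies the optimal set strong convexity condition with parameter $\mu\in(0,L_{\min}]$: for any $x$ and any $\lambda\in[0,1]$, $$F(\lambda x+(1-\lambda)P_\Omega(x))\le\lambda F(x)+(1-\lambda)F^*-\tfrac12\mu\lambda(1-\lambda)\|x-P_\Omega(x)\|^2.$$ Then the iteration complexity for the expected objective value to reach $\mathbb E_{i_0,\dots,i_{k-1}}F(x^k)-F^*\le\epsilon$, for any given $\epsilon>0$, is as follows. When $p^k_i\equiv1/N$ for $i=1,\dots,N$, it is $$O\Big(\frac{NL_{\max}}{(1-\eta)\mu}\log(1/\epsilon)\Big),$$ while when $p^k_i=L_i/(NL_{\mathrm{avg}})$ for $i=1,\dots,N$, it is $$O\Big(\frac{NL_{\mathrm{avg}}}{(1-\eta)\mu}\log(1/\epsilon)\Big).$$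
   Context: Problem. Minimize $F(x)=f(x)+\psi(x)$ over $x\in\mathbb R^n$, where $x=(x_1,\dots,x_N)$ is split into $N$ blocks $x_i\in\mathbb R^{n_i}$, $\sum_i n_i=n$. $U_i\in\mathbb R^{n\times n_i}$ is the column submatrix of the identity with $x_i=U_i^\top x$; $\nabla_if:=U_i^\top\nabla f$. $f:\mathbb R^n\to\mathbb R$ is continuously differentiable and blockwise Lipschitz: $\|\nabla_if(x+U_ih)-\nabla_if(x)\|\le L_i\|h\|$ for all $x\in\mathbb R^n$, $h\in\mathbb R^{n_i}$, with $L_i>0$. $\psi(x)=\sum_i\psi_i(x_i)$ with each $\psi_i$ convex, extended-valued, proper and closed. $F$ is bounded below and its set of minimizers $\Omega$ is nonempty; $F^*$ is the minimum value; $P_\Omega$ is the Euclidean projection onto $\Omega$. $\|\cdot\|$ is the Euclidean norm. In the optimal set strong convexity condition the convention $0\cdot\infty=0$ is used. Algorithm B. Given $\eta\in[0,1)$ and $x^0$ with $F(x^0)<\infty$. At iteration $k=0,1,2,\dots$: with a probability distribution $p^k_1,\dots,p^k_N>0$, $\sum_ip^k_i=1$, sample $i=i_k$ from it. Let $$Q^k_i(d_i):=\nabla_if(x^k)^\top d_i+\tfrac12L_i\|d_i\|^2+\psi_i(x^k_i+d_i)-\psi_i(x^k_i),\qquad Q^{k*}_i:=\inf_{d_i}Q^k_i(d_i),$$ compute $d^k_i$ satisfying $\eta(Q^k_i(0)-Q^{k*}_i)\ge Q^k_i(d^k_i)-Q^{k*}_i$, and set $x^{k+1}=x^k+U_id^k_i$.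 Conventions. $\mathbb E_{i_0,\dots,i_{k-1}}$ is the expectation over the block choices. "Iteration complexity $O(\cdot)$" means that there is $K_\epsilon=O(\cdot)$ such that the expected gap is at most $\epsilon$ for all $k\ge K_\epsilon$; $O(\cdot)$ is understood as $\epsilon\downarrow0$, with an implied constant that may depend on the initial gap $F(x^0)-F^*$ but not on $N$, the $L_i$, $\mu$, $\eta$ or $\epsilon$. *)

theory Defs
  imports "HOL-Probability.Probability"
begin

text \<open>
  The constants hidden in a complexity bound must not depend on the number of blocks or on the
  dimension, so both are quantified inside a formula and cannot be type-indexed.  All vectors
  therefore live in one type, the finitely supported real sequences with the Euclidean inner
  product, and \<open>Rn n\<close> below is the copy of n-dimensional space inside it.
\<close>

typedef evec = "{x :: nat \<Rightarrow> real. finite {i. x i \<noteq> 0}}"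
  morphisms coord Evec
  by (rule exI[of _ "\<lambda>_. 0"]) simp

setup_lifting type_definition_evec

lemma finite_support_coord [simp]: "finite {i. coord x i \<noteq> 0}"
  using coord[of x] by simp

lemma evec_eqI: "(\<And>i. coord x i = coord y i) \<Longrightarrow> x = y"
  by (metis coord_inject ext)

lemma finite_support_Un:
  fixes x y z :: "nat \<Rightarrow> real"
  assumes "finite {i. x i \<noteq> 0}" "finite {i. y i \<noteq> 0}"
    and "\<And>i. x i = 0 \<Longrightarrow> y i = 0 \<Longrightarrow> z i = 0"
  shows "finite {i. z i \<noteq> 0}"
  by (rule finite_subset[OF _ finite_UnI[OF assms(1,2)]]) (use assms(3) in auto)

instantiation evec :: real_vector
begin

lift_definition zero_evec :: evec is "\<lambda>_. 0" by simp

lift_definition plus_evec :: "evec \<Rightarrow> evec \<Rightarrow> evec" is "\<lambda>x y i. x i + y i"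
  by (erule (1) finite_support_Un) simp

lift_definition uminus_evec :: "evec \<Rightarrow> evec" is "\<lambda>x i. - x i" by simp

lift_definition minus_evec :: "evec \<Rightarrow> evec \<Rightarrow> evec" is "\<lambda>x y i. x i - y i"
  by (erule (1) finite_support_Un) simp

lift_definition scaleR_evec :: "real \<Rightarrow> evec \<Rightarrow> evec" is "\<lambda>r x i. r * x i"
  by (rule rev_finite_subset) auto

instance
  by (standard; transfer) (auto simp: fun_eq_iff algebra_simps)

end

lemma coord_simps [simp]:
  "coord 0 i = 0"
  "coord (x + y) i = coord x i + coord y i"
  "coord (- x) i = - coord x i"
  "coord (x - y) i = coord x i - coord y i"
  "coord (r *\<^sub>R x) i = r * coord x i"
  by (transfer; simp)+

instantiation evec :: real_inner
begin

definition inner_evec :: "evec \<Rightarrow> evec \<Rightarrow> real" where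
  "inner_evec x y = (\<Sum>i\<in>{i. coord x i \<noteq> 0}. coord x i * coord y i)"

definition norm_evec :: "evec \<Rightarrow> real" where
  "norm_evec x = sqrt (inner x x)"

definition sgn_evec :: "evec \<Rightarrow> evec" where
  "sgn_evec x = x /\<^sub>R norm x"

definition dist_evec :: "evec \<Rightarrow> evec \<Rightarrow> real" where
  "dist_evec x y = norm (x - y)"

definition uniformity_evec :: "(evec \<times> evec) filter" where
  "uniformity_evec = (INF e\<in>{0<..}. principal {(x, y). dist x y < e})"

definition open_evec :: "evec set \<Rightarrow> bool" where
  "open_evec S \<longleftrightarrow> (\<forall>x\<in>S. \<forall>\<^sub>F (x', y) in uniformity. x' = x \<longrightarrow> y \<in> S)"

lemma inner_evec_superset:
  assumes "finite S" "{i. coord x i \<noteq> 0} \<subseteq> S"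
  shows "inner x y = (\<Sum>i\<in>S. coord x i * coord y i)"
  unfolding inner_evec_def using assms by (intro sum.mono_neutral_left) auto

instance
proof
  fix x y z :: evec and r :: real
  let ?S = "{i. coord x i \<noteq> 0} \<union> {i. coord y i \<noteq> 0}"
  have ip: "inner u v = (\<Sum>i\<in>?S. coord u i * coord v i)" if "{i. coord u i \<noteq> 0} \<subseteq> ?S" for u v
    by (rule inner_evec_superset) (use that in auto)
  show "dist x y = norm (x - y)" by (rule dist_evec_def)
  show "sgn x = x /\<^sub>R norm x" by (rule sgn_evec_def)
  show "norm x = sqrt (inner x x)" by (rule norm_evec_def)
  show "uniformity = (INF e\<in>{0<..}. principal {(x :: evec, y). dist x y < e})"
    by (rule uniformity_evec_def)
  show "open U = (\<forall>x\<in>U. \<forall>\<^sub>F (x', y) in uniformity. x' = x \<longrightarrow> y \<in> U)" for U :: "evec set"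
    by (rule open_evec_def)
  show "inner x y = inner y x"
    by (subst ip, blast)+ (simp add: mult.commute)
  show "inner (x + y) z = inner x z + inner y z"
    by (subst ip, force)+ (simp add: algebra_simps sum.distrib)
  show "inner (r *\<^sub>R x) y = r * inner x y"
    by (subst ip, force)+ (simp add: algebra_simps sum_distrib_left)
  show "0 \<le> inner x x"
    unfolding inner_evec_def by (intro sum_nonneg) simp
  show "inner x x = 0 \<longleftrightarrow> x = 0"
  proof
    assume "inner x x = 0"
    then have "\<forall>i\<in>{i. coord x i \<noteq> 0}. coord x i * coord x i = 0"
      unfolding inner_evec_def by (subst (asm) sum_nonneg_eq_0_iff) auto
    then show "x = 0" by (intro evec_eqI) auto
  qed (simp add: inner_evec_def)
qed

end

definition Rn :: "nat \<Rightarrow> evec set" where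
  "Rn n = {x. \<forall>i\<ge>n. coord x i = 0}"

definition grad :: "nat \<Rightarrow> (evec \<Rightarrow> real) \<Rightarrow> evec \<Rightarrow> evec" where
  "grad n f x = (THE g. g \<in> Rn n \<and> (f has_derivative (\<lambda>h. g \<bullet> h)) (at x within Rn n))"

definition cont_differentiable :: "nat \<Rightarrow> (evec \<Rightarrow> real) \<Rightarrow> bool" where
  "cont_differentiable n f \<longleftrightarrow> f differentiable_on Rn n \<and> continuous_on (Rn n) (grad n f)"

text \<open>
  Block structure: \<open>m i\<close> is the dimension of block \<open>i\<close>, and block \<open>i\<close> occupies the coordinates
  \<open>offset m i, \<dots>, offset m i + m i - 1\<close>.  With \<open>N\<close> blocks the total dimension is \<open>offset m N\<close>.
  \<open>U m i\<close> is the corresponding column submatrix of the identity as a linear map, \<open>UT m i\<close> its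
  transpose.
\<close>

definition offset :: "(nat \<Rightarrow> nat) \<Rightarrow> nat \<Rightarrow> nat" where
  "offset m i = (\<Sum>j<i. m j)"

lift_definition U :: "(nat \<Rightarrow> nat) \<Rightarrow> nat \<Rightarrow> evec \<Rightarrow> evec" is
  "\<lambda>m i h c. if offset m i \<le> c \<and> c < offset m i + m i then h (c - offset m i) else 0"
  by (rule finite_subset[OF _ finite_lessThan]) (auto split: if_splits)

lift_definition UT :: "(nat \<Rightarrow> nat) \<Rightarrow> nat \<Rightarrow> evec \<Rightarrow> evec" is
  "\<lambda>m i x j. if j < m i then x (offset m i + j) else 0"
  by (rule finite_subset[OF _ finite_lessThan]) (auto split: if_splits)

definition ext_epigraph :: "nat \<Rightarrow> (evec \<Rightarrow> ereal) \<Rightarrow> (evec \<times> real) set" where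
  "ext_epigraph d g = {(x, t). x \<in> Rn d \<and> g x \<le> ereal t}"

definition proper_closed_convex :: "nat \<Rightarrow> (evec \<Rightarrow> ereal) \<Rightarrow> bool" where
  "proper_closed_convex d g \<longleftrightarrow>
     (\<forall>x\<in>Rn d. g x \<noteq> -\<infinity>) \<and> (\<exists>x\<in>Rn d. g x \<noteq> \<infinity>) \<and>
     closed (ext_epigraph d g) \<and> convex (ext_epigraph d g)"

definition objective ::
  "nat \<Rightarrow> (nat \<Rightarrow> nat) \<Rightarrow> (evec \<Rightarrow> real) \<Rightarrow> (nat \<Rightarrow> evec \<Rightarrow> ereal) \<Rightarrow> evec \<Rightarrow> ereal" where
  "objective N m f \<psi> x = ereal (f x) + (\<Sum>i<N. \<psi> i (UT m i x))"

definition min_value :: "nat \<Rightarrow> (evec \<Rightarrow> ereal) \<Rightarrow> ereal" where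
  "min_value n F = (INF x\<in>Rn n. F x)"

definition minimizers :: "nat \<Rightarrow> (evec \<Rightarrow> ereal) \<Rightarrow> evec set" where
  "minimizers n F = {x \<in> Rn n. \<forall>y\<in>Rn n. F x \<le> F y}"

text \<open>Same as \<^const>\<open>closest_point\<close>, which is restricted to Heine-Borel types.\<close>

definition nearest :: "evec set \<Rightarrow> evec \<Rightarrow> evec" where
  "nearest S x = (SOME y. y \<in> S \<and> (\<forall>z\<in>S. dist x y \<le> dist x z))"

definition blockwise_Lipschitz ::
  "nat \<Rightarrow> (nat \<Rightarrow> nat) \<Rightarrow> (evec \<Rightarrow> real) \<Rightarrow> (nat \<Rightarrow> real) \<Rightarrow> bool" where
  "blockwise_Lipschitz N m f L \<longleftrightarrow>
     (\<forall>i<N. L i > 0 \<and>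
        (\<forall>x\<in>Rn (offset m N). \<forall>h\<in>Rn (m i).
           norm (UT m i (grad (offset m N) f (x + U m i h)) - UT m i (grad (offset m N) f x))
             \<le> L i * norm h))"

definition composite_problem ::
  "nat \<Rightarrow> (nat \<Rightarrow> nat) \<Rightarrow> (evec \<Rightarrow> real) \<Rightarrow> (nat \<Rightarrow> evec \<Rightarrow> ereal) \<Rightarrow> (nat \<Rightarrow> real) \<Rightarrow> bool" where
  "composite_problem N m f \<psi> L \<longleftrightarrow>
     1 \<le> N \<and> cont_differentiable (offset m N) f \<and> blockwise_Lipschitz N m f L \<and>
     (\<forall>i<N. proper_closed_convex (m i) (\<psi> i)) \<and>
     (\<exists>b::real. \<forall>x\<in>Rn (offset m N). ereal b \<le> objective N m f \<psi> x) \<and>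
     minimizers (offset m N) (objective N m f \<psi>) \<noteq> {}"

text \<open>The convention \<open>0 * \<infinity> = 0\<close> is the one built into multiplication on \<^typ>\<open>ereal\<close>.\<close>

definition optimal_set_strongly_convex :: "nat \<Rightarrow> (evec \<Rightarrow> ereal) \<Rightarrow> real \<Rightarrow> bool" where
  "optimal_set_strongly_convex n F \<mu> \<longleftrightarrow>
     (\<forall>x\<in>Rn n. \<forall>t\<in>{0..1}.
        let P = nearest (minimizers n F) x in
        F (t *\<^sub>R x + (1 - t) *\<^sub>R P)
          \<le> ereal t * F x + ereal (1 - t) * min_value n F
            - ereal (1 / 2 * \<mu> * t * (1 - t) * (norm (x - P))\<^sup>2))"

definition Q ::
  "nat \<Rightarrow> (nat \<Rightarrow> nat) \<Rightarrow> (evec \<Rightarrow> real) \<Rightarrow> (nat \<Rightarrow> evec \<Rightarrow> ereal) \<Rightarrow> (nat \<Rightarrow> real) \<Rightarrow>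
    evec \<Rightarrow> nat \<Rightarrow> evec \<Rightarrow> ereal" where
  "Q N m f \<psi> L x i d =
     ereal (UT m i (grad (offset m N) f x) \<bullet> d + 1 / 2 * L i * (norm d)\<^sup>2)
     + \<psi> i (UT m i x + d) - \<psi> i (UT m i x)"

definition Q_inf ::
  "nat \<Rightarrow> (nat \<Rightarrow> nat) \<Rightarrow> (evec \<Rightarrow> real) \<Rightarrow> (nat \<Rightarrow> evec \<Rightarrow> ereal) \<Rightarrow> (nat \<Rightarrow> real) \<Rightarrow>
    evec \<Rightarrow> nat \<Rightarrow> ereal" where
  "Q_inf N m f \<psi> L x i = (INF d\<in>Rn (m i). Q N m f \<psi> L x i d)"

text \<open>
  A run of the method is indexed by the history \<open>[i\<^sub>0, \<dots>, i\<^sub>k\<^sub>-\<^sub>1]\<close> of sampled blocks: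
  \<open>x h\<close> is the iterate reached after history \<open>h\<close>, and \<open>d h i\<close> is the update that is computed at
  that point if block \<open>i\<close> is sampled next.  Any rule meeting the inexactness criterion is allowed.
\<close>

definition inexact_rbcd ::
  "nat \<Rightarrow> (nat \<Rightarrow> nat) \<Rightarrow> (evec \<Rightarrow> real) \<Rightarrow> (nat \<Rightarrow> evec \<Rightarrow> ereal) \<Rightarrow> (nat \<Rightarrow> real) \<Rightarrow> real \<Rightarrow>
    (nat \<Rightarrow> nat pmf) \<Rightarrow> (nat list \<Rightarrow> evec) \<Rightarrow> (nat list \<Rightarrow> nat \<Rightarrow> evec) \<Rightarrow> bool" where
  "inexact_rbcd N m f \<psi> L \<eta> p x d \<longleftrightarrow>
     (\<forall>k. set_pmf (p k) = {..<N}) \<and>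
     x [] \<in> Rn (offset m N) \<and> objective N m f \<psi> (x []) < \<infinity> \<and>
     (\<forall>h i. set h \<subseteq> {..<N} \<and> i < N \<longrightarrow>
        d h i \<in> Rn (m i) \<and>
        ereal \<eta> * (Q N m f \<psi> L (x h) i 0 - Q_inf N m f \<psi> L (x h) i)
          \<ge> Q N m f \<psi> L (x h) i (d h i) - Q_inf N m f \<psi> L (x h) i \<and>
        x (h @ [i]) = x h + U m i (d h i))"

text \<open>The joint law of the independent choices \<open>i\<^sub>0, \<dots>, i\<^sub>k\<^sub>-\<^sub>1\<close>.\<close>

primrec history_pmf :: "(nat \<Rightarrow> nat pmf) \<Rightarrow> nat \<Rightarrow> nat list pmf" where
  "history_pmf p 0 = return_pmf []"
| "history_pmf p (Suc k) =
     bind_pmf (history_pmf p k) (\<lambda>h. map_pmf (\<lambda>i. h @ [i]) (p k))"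

text \<open>
  Expectation of an extended-valued function under a distribution with finite support; unlike the
  Bochner integral of the real part, it does not turn infinite values into 0.
\<close>

definition ereal_expectation :: "'a pmf \<Rightarrow> ('a \<Rightarrow> ereal) \<Rightarrow> ereal" where
  "ereal_expectation M g = (\<Sum>h\<in>set_pmf M. ereal (pmf M h) * g h)"

definition expected_gap ::
  "nat \<Rightarrow> (nat \<Rightarrow> nat) \<Rightarrow> (evec \<Rightarrow> real) \<Rightarrow> (nat \<Rightarrow> evec \<Rightarrow> ereal) \<Rightarrow>
    (nat \<Rightarrow> nat pmf) \<Rightarrow> (nat list \<Rightarrow> evec) \<Rightarrow> nat \<Rightarrow> ereal" where
  "expected_gap N m f \<psi> p x k =
     ereal_expectation (history_pmf p k) (\<lambda>h. objective N m f \<psi> (x h))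
     - min_value (offset m N) (objective N m f \<psi>)"

text \<open>
  The complexity for \<open>gap\<close> to become and stay at most \<open>\<epsilon>\<close> is bounded by \<open>C * B \<epsilon>\<close> for all
  \<open>\<epsilon> < \<epsilon>0\<close>.  Uniformity of an O-bound is expressed by choosing \<open>C\<close> and \<open>\<epsilon>0\<close> before the instance.
\<close>

definition complexity_within :: "real \<Rightarrow> real \<Rightarrow> (real \<Rightarrow> real) \<Rightarrow> (nat \<Rightarrow> ereal) \<Rightarrow> bool" where
  "complexity_within C \<epsilon>0 B gap \<longleftrightarrow>
     (\<exists>K :: real \<Rightarrow> nat.
        (\<forall>\<epsilon>>0. \<forall>k\<ge>K \<epsilon>. gap k \<le> ereal \<epsilon>) \<and>
        (\<forall>\<epsilon>. 0 < \<epsilon> \<and> \<epsilon> < \<epsilon>0 \<longrightarrow> real (K \<epsilon>) \<le> C * B \<epsilon>))"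

definition L_max :: "nat \<Rightarrow> (nat \<Rightarrow> real) \<Rightarrow> real" where
  "L_max N L = Max (L ` {..<N})"

definition L_min :: "nat \<Rightarrow> (nat \<Rightarrow> real) \<Rightarrow> real" where
  "L_min N L = Min (L ` {..<N})"

definition L_avg :: "nat \<Rightarrow> (nat \<Rightarrow> real) \<Rightarrow> real" where
  "L_avg N L = 1 / real N * (\<Sum>i<N. L i)"

end

theory Submission
  imports Defs
begin

text \<open>
  Both complexity bounds come from one contraction estimate for an arbitrary sampling
  distribution \<open>p\<close>. If \<open>t > 0\<close> satisfies \<open>t * L i \<le> \<mu> * p i\<close> for every block \<open>i\<close>, then each iteration
  reduces the expected gap by the factor \<open>1 - (1 - \<eta>) * t / 2\<close>.

  The block model \<open>Q\<close> majorizes the change of the objective under a block step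
  (\<open>objective_le_model\<close>), so a step meeting the inexactness criterion lowers the objective by at
  least \<open>1 - \<eta>\<close> times the best model decrease (\<open>inexact_step_decrease\<close>). It remains to bound the
  expected best model decrease from below (\<open>expected_model_decrease\<close>). For this, block \<open>i\<close> is given a trial
  step: the fraction \<open>t / p i\<close> of the block component of \<open>(P - x) / 2\<close>, where \<open>P\<close> is the projection of
  \<open>x\<close> onto the optimal set. The probabilities cancel against the fractions, convexity turns the sum of the
  first-order terms into \<open>t\<close> times the change of \<open>F\<close> from \<open>x\<close> to the midpoint of \<open>x\<close> and \<open>P\<close>, and the
  condition on \<open>t\<close> makes the quadratic terms no larger than what optimal set strong convexity
  gains at the midpoint. What is left is half of the gap, times \<open>t\<close>.

  The largest admissible \<open>t\<close> is \<open>\<mu> / (N * L_max)\<close> for uniform sampling and \<open>\<mu> / (N * L_avg)\<close> for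
  probabilities proportional to the \<open>L i\<close>. A geometric rate \<open>1 - c\<close> yields \<open>\<epsilon>\<close>-accuracy after
  \<open>O(ln (1 / \<epsilon>) / c)\<close> iterations (\<open>complexity_within_geometric\<close>).

  Two points need care with extended values. The projection onto the optimal set has to exist, which follows
  from lower semicontinuity of the objective and compactness in finite dimension (\<open>nearest_in\<close>,
  \<open>closed_minimizers\<close>); and the model infimum has to be finite (\<open>Q_inf_finite\<close>), which follows from the
  majorization because the objective is bounded below.
\<close>

section \<open>Finite-dimensional coordinate subspaces\<close>

lift_definition axis_evec :: "nat \<Rightarrow> evec" is "\<lambda>j i. if i = j then 1 else 0"
  by simp

lemma coord_axis [simp]: "coord (axis_evec j) i = (if i = j then 1 else 0)"
  by transfer simp

lemma inner_axis: "axis_evec j \<bullet> x = coord x j"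
proof -
  have "axis_evec j \<bullet> x = (\<Sum>i\<in>{j}. coord (axis_evec j) i * coord x i)"
    by (rule inner_evec_superset) auto
  then show ?thesis by simp
qed

lemma coord_sum: "coord (sum g A) i = (\<Sum>a\<in>A. coord (g a) i)"
  by (induction A rule: infinite_finite_induct) auto

lemma inner_Rn:
  assumes "x \<in> Rn n"
  shows "x \<bullet> y = (\<Sum>i<n. coord x i * coord y i)"
proof (rule inner_evec_superset)
  show "{i. coord x i \<noteq> 0} \<subseteq> {..<n}"
    using assms unfolding Rn_def by (auto simp: not_less) (meson not_less)
qed simp

lemma abs_coord_le_norm: "\<bar>coord x i\<bar> \<le> norm x"
proof -
  have "norm (axis_evec i) = 1"
    by (simp add: norm_eq_sqrt_inner inner_axis)
  then show ?thesis
    using Cauchy_Schwarz_ineq2[of "axis_evec i" x] by (simp add: inner_axis)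
qed

lemma subspace_Rn: "subspace (Rn n)"
  by (auto simp: subspace_def Rn_def)

lemmas Rn_closure = subspace_Rn[THEN subspace_add] subspace_Rn[THEN subspace_diff]
  subspace_Rn[THEN subspace_scale] subspace_Rn[THEN subspace_0]

text \<open>
  In finite dimension a linear functional is determined by its values on the axis vectors, which are
  then the coordinates of its gradient.
\<close>

lemma Rn_expansion:
  assumes "x \<in> Rn n"
  shows "x = (\<Sum>j<n. coord x j *\<^sub>R axis_evec j)"
proof (rule evec_eqI)
  fix i
  have "(\<Sum>j<n. coord x j * coord (axis_evec j) i) = (\<Sum>j<n. if j = i then coord x j else 0)"
    by (rule sum.cong) auto
  then show "coord x i = coord (\<Sum>j<n. coord x j *\<^sub>R axis_evec j) i"
    using assms by (auto simp: coord_sum Rn_def)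
qed

lemma continuous_on_coord: "continuous_on S (\<lambda>x. coord x i)"
  unfolding inner_axis[symmetric] by (intro continuous_intros)

lemma closed_Rn: "closed (Rn n)"
proof -
  have "closed {x. \<forall>i. n \<le> i \<longrightarrow> coord x i = 0}"
    by (intro closed_Collect_all closed_Collect_imp closed_Collect_eq open_Collect_const
        continuous_on_coord continuous_on_const)
  then show ?thesis by (simp add: Rn_def)
qed

text \<open>
  Bounded closed sets of \<^typ>\<open>evec\<close> need not be compact, but boxes inside \<^term>\<open>Rn n\<close> are: the box of
  dimension \<open>n + 1\<close> is a continuous image of the product of the box of dimension \<open>n\<close> and an interval.
\<close>

lemma compact_box: "compact {x \<in> Rn n. \<forall>i<n. \<bar>coord x i\<bar> \<le> B}"
proof (induction n)
  case 0
  have "{x \<in> Rn 0. \<forall>i<0. \<bar>coord x i\<bar> \<le> B} = {0}"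
    by (auto simp: Rn_def intro: evec_eqI)
  then show ?case by (simp only: compact_sing)
next
  case (Suc n)
  let ?K = "{x \<in> Rn n. \<forall>i<n. \<bar>coord x i\<bar> \<le> B}"
  let ?g = "\<lambda>(x, r). x + r *\<^sub>R axis_evec n"
  have "{x \<in> Rn (Suc n). \<forall>i<Suc n. \<bar>coord x i\<bar> \<le> B} = ?g ` (?K \<times> {-B..B})"
  proof (intro equalityI subsetI)
    fix x assume x: "x \<in> {x \<in> Rn (Suc n). \<forall>i<Suc n. \<bar>coord x i\<bar> \<le> B}"
    let ?y = "x - coord x n *\<^sub>R axis_evec n"
    have "\<bar>coord x n\<bar> \<le> B" using x by blast
    moreover have "?y \<in> ?K"
      using x by (auto simp: Rn_def Suc_le_eq)
    ultimately have "(?y, coord x n) \<in> ?K \<times> {-B..B}" by (simp add: abs_le_iff)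
    then show "x \<in> ?g ` (?K \<times> {-B..B})"
      by (rule rev_image_eqI) simp
  next
    fix x assume "x \<in> ?g ` (?K \<times> {-B..B})"
    then show "x \<in> {x \<in> Rn (Suc n). \<forall>i<Suc n. \<bar>coord x i\<bar> \<le> B}"
      by (auto simp: Rn_def less_Suc_eq)
  qed
  moreover have "compact (?g ` (?K \<times> {-B..B}))"
    by (intro compact_continuous_image compact_Times Suc compact_Icc)
       (auto simp: case_prod_unfold intro!: continuous_intros)
  ultimately show ?case by (simp only:)
qed

text \<open>
  Only points of \<open>S\<close> no farther from \<open>x\<close> than a fixed \<open>z\<close> can be nearest. They form a closed subset of a
  compact box, on which the distance attains its minimum.
\<close>

lemma nearest_in:
  assumes "closed S" "S \<subseteq> Rn n" "S \<noteq> {}"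
  shows "nearest S x \<in> S"
proof -
  obtain z where z: "z \<in> S" using assms(3) by blast
  let ?B = "norm x + dist x z"
  let ?K = "S \<inter> cball x (dist x z)"
  let ?Box = "{y \<in> Rn n. \<forall>i<n. \<bar>coord y i\<bar> \<le> ?B}"
  have K_sub: "?K \<subseteq> ?Box"
  proof (intro subsetI CollectI conjI allI impI)
    fix y assume y: "y \<in> ?K"
    then show "y \<in> Rn n" using assms(2) by blast
    fix i
    have "norm y \<le> norm x + dist x y"
      by (metis dist_commute dist_norm norm_triangle_sub)
    then show "\<bar>coord y i\<bar> \<le> ?B"
      using y abs_coord_le_norm[of y i] by simp
  qed
  have "closed ?K" by (intro closed_Int assms(1) closed_cball)
  then have "compact (?Box \<inter> ?K)"
    by (rule compact_Int_closed[OF compact_box])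
  then have "compact ?K"
    using K_sub by (simp only: Int_absorb1)
  moreover have "?K \<noteq> {}" using z by auto
  moreover have "continuous_on ?K (dist x)" by (intro continuous_intros)
  ultimately have "\<exists>y\<in>?K. \<forall>w\<in>?K. dist x y \<le> dist x w"
    by (rule continuous_attains_inf)
  then obtain y where y: "y \<in> ?K" "\<And>w. w \<in> ?K \<Longrightarrow> dist x y \<le> dist x w"
    by blast
  have "dist x y \<le> dist x w" if "w \<in> S" for w
    using y that by (cases "dist x w \<le> dist x z") auto
  then have "\<exists>y. y \<in> S \<and> (\<forall>w\<in>S. dist x y \<le> dist x w)" using y by blast
  then show ?thesis unfolding nearest_def by (rule someI_ex[THEN conjunct1])
qed

section \<open>Gradients\<close>

lemma has_derivative_within_Rn_line:
  assumes "(f has_derivative (\<lambda>h. g \<bullet> h)) (at (x + t *\<^sub>R v) within Rn n)" "x \<in> Rn n" "v \<in> Rn n"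
  shows "((\<lambda>s. f (x + s *\<^sub>R v)) has_real_derivative g \<bullet> v) (at t)"
proof -
  have "((\<lambda>s. x + s *\<^sub>R v) has_derivative (\<lambda>s. s *\<^sub>R v)) (at t)"
    by (auto intro!: derivative_eq_intros)
  moreover have "(f has_derivative (\<lambda>h. g \<bullet> h))
      (at (x + t *\<^sub>R v) within (range (\<lambda>s. x + s *\<^sub>R v)))"
    by (rule has_derivative_subset[OF assms(1)]) (auto intro: Rn_closure assms)
  ultimately have "((\<lambda>s. f (x + s *\<^sub>R v)) has_derivative (\<lambda>s. g \<bullet> (s *\<^sub>R v))) (at t)"
    by (rule has_derivative_in_compose)
  then show ?thesis
    by (simp add: has_field_derivative_def mult.commute[of _ "g \<bullet> v"])
qed

text \<open>
  A derivative within \<^term>\<open>Rn n\<close> is determined only on \<^term>\<open>Rn n\<close>; requiring the gradient to lie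
  there makes it unique, so that the description in the definition of \<^const>\<open>grad\<close> denotes.
\<close>

lemma grad_has_derivative:
  assumes "f differentiable_on Rn n" "x \<in> Rn n"
  shows "(f has_derivative (\<lambda>h. grad n f x \<bullet> h)) (at x within Rn n)"
proof -
  let ?is_grad = "\<lambda>g. g \<in> Rn n \<and> (f has_derivative (\<lambda>h. g \<bullet> h)) (at x within Rn n)"
  obtain D where D: "(f has_derivative D) (at x within Rn n)"
    using assms unfolding differentiable_on_def differentiable_def by blast
  define g where "g = (\<Sum>j<n. D (axis_evec j) *\<^sub>R axis_evec j)"
  have gRn: "g \<in> Rn n"
    unfolding g_def by (intro subspace_sum[OF subspace_Rn] Rn_closure) (auto simp: Rn_def)
  have D_inner: "D h = g \<bullet> h" if "h \<in> Rn n" for h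
  proof -
    have lin: "linear D" using D by (simp add: has_derivative_linear)
    have "D h = D (\<Sum>j<n. coord h j *\<^sub>R axis_evec j)" using Rn_expansion[OF that] by simp
    also have "\<dots> = (\<Sum>j<n. coord h j * D (axis_evec j))"
      by (simp add: linear_sum[OF lin] linear_scale[OF lin])
    also have "\<dots> = g \<bullet> h"
      by (simp add: g_def inner_sum_left inner_axis mult.commute)
    finally show ?thesis .
  qed
  have "?is_grad g"
  proof
    show "(f has_derivative (\<lambda>h. g \<bullet> h)) (at x within Rn n)"
      using D D_inner assms(2)
      unfolding has_derivative_within' by (simp add: bounded_linear_inner_right Rn_closure)
  qed (rule gRn)
  moreover have "g' = g" if g': "?is_grad g'" for g'
  proof -
    let ?v = "g' - g"
    have v: "?v \<in> Rn n" using g' gRn by (simp add: Rn_closure)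
    have "g' \<bullet> ?v = g \<bullet> ?v"
      using has_derivative_within_Rn_line[of f g' x 0 ?v n] has_derivative_within_Rn_line[of f g x 0 ?v n]
        g' \<open>?is_grad g\<close> v assms(2) DERIV_unique by simp
    then have "?v \<bullet> ?v = 0" by (simp add: inner_diff_left)
    then show ?thesis by simp
  qed
  ultimately have "?is_grad (grad n f x)"
    unfolding grad_def by (rule theI)
  then show ?thesis by blast
qed

lemma DERIV_along_line:
  assumes "f differentiable_on Rn n" "x \<in> Rn n" "v \<in> Rn n"
  shows "((\<lambda>s. f (x + s *\<^sub>R v)) has_real_derivative grad n f (x + t *\<^sub>R v) \<bullet> v) (at t)"
  by (rule has_derivative_within_Rn_line[OF grad_has_derivative]) (intro Rn_closure assms)+

lemma convex_above_tangent:
  assumes "f differentiable_on Rn n" "convex_on (Rn n) f" "x \<in> Rn n" "v \<in> Rn n"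
  shows "f x + grad n f x \<bullet> v \<le> f (x + v)"
proof -
  let ?\<phi> = "\<lambda>s. f (x + s *\<^sub>R v)"
  have "convex_on UNIV ?\<phi>"
  proof (intro convex_onI)
    fix t a b :: real assume "0 < t" "t < 1"
    have "x + ((1 - t) *\<^sub>R a + t *\<^sub>R b) *\<^sub>R v = (1 - t) *\<^sub>R (x + a *\<^sub>R v) + t *\<^sub>R (x + b *\<^sub>R v)"
      by (simp add: algebra_simps)
    then show "?\<phi> ((1 - t) *\<^sub>R a + t *\<^sub>R b) \<le> (1 - t) * ?\<phi> a + t * ?\<phi> b"
      using convex_onD[OF assms(2), of t "x + a *\<^sub>R v" "x + b *\<^sub>R v"] \<open>0 < t\<close> \<open>t < 1\<close> assms
      by (simp add: Rn_closure)
  qed simp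
  moreover have "(?\<phi> has_real_derivative grad n f x \<bullet> v) (at 0)"
    using DERIV_along_line[OF assms(1,3,4), of 0] by simp
  ultimately have "?\<phi> 1 - ?\<phi> 0 \<ge> (grad n f x \<bullet> v) * (1 - 0)"
    by (intro convex_on_imp_above_tangent) auto
  then show ?thesis by simp
qed

text \<open>
  The descent lemma without integration: the difference of the two sides, along the segment from
  \<open>x\<close> to \<open>x + v\<close>, has a derivative of constant sign.
\<close>

lemma upper_quadratic_bound:
  assumes f: "f differentiable_on Rn n" and x: "x \<in> Rn n" and v: "v \<in> Rn n"
    and growth: "\<And>s. 0 \<le> s \<Longrightarrow> s \<le> 1 \<Longrightarrow>
      (grad n f (x + s *\<^sub>R v) - grad n f x) \<bullet> v \<le> s * M"
  shows "f (x + v) \<le> f x + grad n f x \<bullet> v + 1/2 * M"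
proof -
  let ?\<phi> = "\<lambda>s. f (x + s *\<^sub>R v) - s * (grad n f x \<bullet> v) - s\<^sup>2 / 2 * M"
  have "?\<phi> 1 \<le> ?\<phi> 0"
  proof (rule DERIV_nonpos_imp_nonincreasing[where f = ?\<phi> and a = 0 and b = 1])
    fix s :: real assume s: "0 \<le> s" "s \<le> 1"
    have "(?\<phi> has_real_derivative
        grad n f (x + s *\<^sub>R v) \<bullet> v - grad n f x \<bullet> v - s * M) (at s)"
      by (auto intro!: derivative_eq_intros DERIV_along_line[OF f x v])
    moreover have "grad n f (x + s *\<^sub>R v) \<bullet> v - grad n f x \<bullet> v - s * M \<le> 0"
      using growth[OF s] by (simp add: inner_diff_left)
    ultimately show "\<exists>y. (?\<phi> has_real_derivative y) (at s) \<and> y \<le> 0" by blast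
  qed simp
  then show ?thesis by simp
qed

section \<open>Block structure\<close>

lemma offset_Suc: "offset m (Suc i) = offset m i + m i"
  by (simp add: offset_def)

lemma offset_add_le: "i < N \<Longrightarrow> offset m i + m i \<le> offset m N"
proof (induction N)
  case (Suc N)
  then show ?case by (cases "i = N") (auto simp: offset_Suc)
qed simp

lemmas coord_U = U.rep_eq and coord_UT = UT.rep_eq

lemma U_in_Rn: "i < N \<Longrightarrow> U m i h \<in> Rn (offset m N)"
  using offset_add_le[of i N m] by (auto simp: Rn_def coord_U)

lemma UT_in_Rn: "UT m i x \<in> Rn (m i)"
  by (auto simp: Rn_def coord_UT)

lemma U_scaleR: "U m i (r *\<^sub>R h) = r *\<^sub>R U m i h"
  by (rule evec_eqI) (simp add: coord_U)

lemma UT_add: "UT m i (x + y) = UT m i x + UT m i y"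
  and UT_diff: "UT m i (x - y) = UT m i x - UT m i y"
  and UT_scaleR: "UT m i (r *\<^sub>R x) = r *\<^sub>R UT m i x"
  by (rule evec_eqI; simp add: coord_UT)+

lemma UT_U_same: "h \<in> Rn (m i) \<Longrightarrow> UT m i (U m i h) = h"
  by (rule evec_eqI) (auto simp: coord_U coord_UT Rn_def)

lemma UT_U_other:
  assumes "i \<noteq> j"
  shows "UT m j (U m i h) = 0"
proof -
  have "offset m i + m i \<le> offset m j \<or> offset m j + m j \<le> offset m i"
    using assms offset_add_le[of i j m] offset_add_le[of j i m] by linarith
  then show ?thesis by (intro evec_eqI) (auto simp: coord_U coord_UT)
qed

text \<open>
  \<^term>\<open>U m i\<close> and \<^term>\<open>UT m i\<close> are adjoint; norms and derivatives along a block all reduce to this.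
\<close>

lemma inner_U: "x \<bullet> U m i h = UT m i x \<bullet> h"
proof -
  let ?o = "offset m i"
  have "x \<bullet> U m i h = (\<Sum>c\<in>{?o..<?o + m i}. coord (U m i h) c * coord x c)"
    by (subst inner_commute, rule inner_evec_superset) (auto simp: coord_U split: if_splits)
  also have "\<dots> = (\<Sum>j<m i. coord (U m i h) (?o + j) * coord x (?o + j))"
    by (rule sum.reindex_bij_witness[of _ "\<lambda>j. ?o + j" "\<lambda>c. c - ?o"]) auto
  also have "\<dots> = (\<Sum>j<m i. coord (UT m i x) j * coord h j)"
    by (rule sum.cong) (auto simp: coord_U coord_UT)
  finally show ?thesis by (simp add: inner_Rn[OF UT_in_Rn])
qed

lemma inner_blocks:
  assumes "u \<in> Rn (offset m N)"
  shows "u \<bullet> v = (\<Sum>i<N. UT m i u \<bullet> UT m i v)"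
proof -
  have "(\<Sum>i<N. UT m i u \<bullet> UT m i v) = (\<Sum>c<offset m N. coord u c * coord v c)"
  proof (induction N)
    case (Suc N)
    have "(\<Sum>j<m N. coord u (offset m N + j) * coord v (offset m N + j))
        = (\<Sum>c\<in>{offset m N..<offset m N + m N}. coord u c * coord v c)"
      by (rule sum.reindex_bij_witness[of _ "\<lambda>c. c - offset m N" "\<lambda>j. offset m N + j"]) auto
    moreover have "(\<Sum>c\<in>{0..<offset m N}. coord u c * coord v c)
          + (\<Sum>c\<in>{offset m N..<offset m N + m N}. coord u c * coord v c)
        = (\<Sum>c\<in>{0..<offset m N + m N}. coord u c * coord v c)"
      by (rule sum.atLeastLessThan_concat) auto
    ultimately show ?case
      using Suc by (simp add: offset_Suc inner_Rn[OF UT_in_Rn] coord_UT atLeast0LessThan)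
  qed (simp add: offset_def)
  then show ?thesis by (simp add: inner_Rn[OF assms])
qed

lemma norm_UT_le: "norm (UT m i x) \<le> norm x"
proof -
  let ?u = "UT m i x"
  have "norm ?u * norm ?u = x \<bullet> U m i ?u"
    by (simp add: inner_U power2_norm_eq_inner[symmetric] power2_eq_square)
  also have "\<dots> \<le> norm x * norm (U m i ?u)" by (rule norm_cauchy_schwarz)
  also have "norm (U m i ?u) = norm ?u"
    by (simp add: norm_eq_sqrt_inner inner_U UT_U_same UT_in_Rn)
  finally show ?thesis
    by (cases "norm ?u = 0") (auto simp: mult_le_cancel_right)
qed

lemma bounded_linear_UT: "bounded_linear (UT m i)"
  by (rule bounded_linear_intro[of _ 1]) (simp_all add: UT_add UT_scaleR norm_UT_le)

lemma block_descent:
  assumes "cont_differentiable (offset m N) f" "blockwise_Lipschitz N m f L"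
    and x: "x \<in> Rn (offset m N)" and i: "i < N" and h: "h \<in> Rn (m i)"
  shows "f (x + U m i h)
    \<le> f x + (UT m i (grad (offset m N) f x) \<bullet> h + 1 / 2 * L i * (norm h)\<^sup>2)"
proof -
  let ?g = "grad (offset m N) f"
  have "f (x + U m i h) \<le> f x + ?g x \<bullet> U m i h + 1/2 * (L i * (norm h)\<^sup>2)"
  proof (rule upper_quadratic_bound)
    show "f differentiable_on Rn (offset m N)"
      using assms(1) by (simp add: cont_differentiable_def)
    fix s :: real assume s: "0 \<le> s" "s \<le> 1"
    have "(?g (x + s *\<^sub>R U m i h) - ?g x) \<bullet> U m i h
        \<le> norm (UT m i (?g (x + U m i (s *\<^sub>R h))) - UT m i (?g x)) * norm h"
      by (simp add: inner_U UT_diff U_scaleR norm_cauchy_schwarz)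
    also have "\<dots> \<le> L i * norm (s *\<^sub>R h) * norm h"
      using assms(2) x i Rn_closure(3)[OF h, of s]
      by (intro mult_right_mono) (auto simp: blockwise_Lipschitz_def simp del: norm_scaleR)
    finally show "(?g (x + s *\<^sub>R U m i h) - ?g x) \<bullet> U m i h \<le> s * (L i * (norm h)\<^sup>2)"
      using s by (simp add: power2_eq_square mult_ac)
  qed (use x U_in_Rn i in auto)
  then show ?thesis by (simp add: inner_U)
qed

section \<open>Closed convex extended-valued functions\<close>

text \<open>
  A closed epigraph gives sequential lower semicontinuity: a level \<open>t < g v\<close> puts \<open>(v, t)\<close> in the open
  complement of the epigraph, hence eventually \<open>(u k, t)\<close> as well.
\<close>

lemma proper_closed_convex_le_liminf:
  assumes g: "proper_closed_convex d g" and u: "\<And>k. u k \<in> Rn d" "u \<longlonglongrightarrow> v"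
  shows "g v \<le> liminf (\<lambda>k. g (u k))"
proof (rule dense_le)
  fix s assume s: "s < g v"
  show "s \<le> liminf (\<lambda>k. g (u k))"
  proof (cases s)
    case (real t)
    have "(\<lambda>k. (u k, t)) \<longlonglongrightarrow> (v, t)" by (intro tendsto_Pair u tendsto_const)
    moreover have "open (- ext_epigraph d g)" using g by (auto simp: proper_closed_convex_def)
    moreover have "(v, t) \<in> - ext_epigraph d g" using s real by (auto simp: ext_epigraph_def)
    ultimately have "\<forall>\<^sub>F k in sequentially. (u k, t) \<in> - ext_epigraph d g"
      by (rule topological_tendstoD)
    then have "\<forall>\<^sub>F k in sequentially. s \<le> g (u k)"
      by (rule eventually_mono) (use u(1) real in \<open>auto simp: ext_epigraph_def\<close>)
    then show ?thesis by (rule Liminf_bounded)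
  qed (use s in auto)
qed

lemma sum_not_MInfty:
  fixes a :: "'i \<Rightarrow> ereal"
  shows "(\<And>i. i \<in> I \<Longrightarrow> a i \<noteq> -\<infinity>) \<Longrightarrow> (\<Sum>i\<in>I. a i) \<noteq> -\<infinity>"
  by (induction I rule: infinite_finite_induct) auto

text \<open>
  Lower semicontinuity of a sum. Excluding the value \<open>-\<infinity>\<close> is what avoids \<open>\<infinity> - \<infinity>\<close>.
\<close>

lemma sum_le_liminf_sum:
  fixes a :: "'i \<Rightarrow> ereal" and b :: "'i \<Rightarrow> nat \<Rightarrow> ereal"
  assumes "finite I" "\<And>i. i \<in> I \<Longrightarrow> a i \<noteq> -\<infinity>" "\<And>i. i \<in> I \<Longrightarrow> a i \<le> liminf (b i)"
  shows "(\<Sum>i\<in>I. a i) \<le> liminf (\<lambda>k. \<Sum>i\<in>I. b i k)"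
  using assms
proof (induction I rule: finite_induct)
  case empty
  then show ?case by (simp add: Liminf_const)
next
  case (insert j I)
  have IH: "(\<Sum>i\<in>I. a i) \<le> liminf (\<lambda>k. \<Sum>i\<in>I. b i k)" using insert by simp
  have "(\<Sum>i\<in>I. a i) \<noteq> -\<infinity>" using insert.prems(1) by (intro sum_not_MInfty) auto
  then have "liminf (\<lambda>k. \<Sum>i\<in>I. b i k) \<noteq> -\<infinity>" "liminf (b j) \<noteq> -\<infinity>"
    using IH insert.prems(1)[of j] insert.prems(2)[of j] by auto
  then have "liminf (b j) + liminf (\<lambda>k. \<Sum>i\<in>I. b i k) \<le> liminf (\<lambda>k. b j k + (\<Sum>i\<in>I. b i k))"
    by (intro ereal_liminf_add_mono) auto
  moreover have "a j + (\<Sum>i\<in>I. a i) \<le> liminf (b j) + liminf (\<lambda>k. \<Sum>i\<in>I. b i k)"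
    using IH insert.prems(2)[of j] by (intro add_mono) auto
  ultimately show ?case using insert.hyps by simp
qed

lemma proper_closed_convex_segment:
  assumes g: "proper_closed_convex d g" and uv: "u \<in> Rn d" "v \<in> Rn d" "g u = ereal a" "g v = ereal b"
    and t: "0 \<le> t" "t \<le> 1"
  obtains c where "g (u + t *\<^sub>R (v - u)) = ereal c" "c \<le> a + t * (b - a)"
proof -
  have "(1 - t) *\<^sub>R (u, a) + t *\<^sub>R (v, b) \<in> ext_epigraph d g"
    using g uv t unfolding proper_closed_convex_def
    by (intro convexD) (auto simp: ext_epigraph_def)
  then have "g (u + t *\<^sub>R (v - u)) \<le> ereal (a + t * (b - a))" "u + t *\<^sub>R (v - u) \<in> Rn d"
    by (simp_all add: ext_epigraph_def algebra_simps)
  moreover have "g (u + t *\<^sub>R (v - u)) \<noteq> -\<infinity>"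
    using calculation(2) g by (auto simp: proper_closed_convex_def)
  ultimately show ?thesis using that by (cases "g (u + t *\<^sub>R (v - u))") auto
qed

section \<open>Decrease in one step\<close>

text \<open>
  On the effective domain \<open>domF\<close> the objective, the block terms \<open>\<psi> i\<close> and the model infima are real
  numbers. Passing to their real values there (\<open>gap\<close>, \<open>\<phi>\<close>, \<open>Qinf\<close>) keeps the estimates free of extended
  arithmetic.
\<close>

locale convex_composite =
  fixes N :: nat and m :: "nat \<Rightarrow> nat" and f :: "evec \<Rightarrow> real"
    and \<psi> :: "nat \<Rightarrow> evec \<Rightarrow> ereal" and L :: "nat \<Rightarrow> real"
  assumes composite: "composite_problem N m f \<psi> L"
    and f_convex: "convex_on (Rn (offset m N)) f"
begin

abbreviation n :: nat where "n \<equiv> offset m N"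
abbreviation F :: "evec \<Rightarrow> ereal" where "F \<equiv> objective N m f \<psi>"
abbreviation Fmin :: ereal where "Fmin \<equiv> min_value n F"
abbreviation gap :: "evec \<Rightarrow> real" where "gap x \<equiv> real_of_ereal (F x) - real_of_ereal Fmin"

definition \<phi> :: "nat \<Rightarrow> evec \<Rightarrow> real" where
  "\<phi> i u = real_of_ereal (\<psi> i u)"

definition Qinf :: "evec \<Rightarrow> nat \<Rightarrow> real" where
  "Qinf x i = real_of_ereal (Q_inf N m f \<psi> L x i)"

definition domF :: "evec set" where
  "domF = {x \<in> Rn n. F x < \<infinity>}"

lemma
  shows f_C1: "cont_differentiable n f"
    and f_diff: "f differentiable_on Rn n"
    and f_Lipschitz: "blockwise_Lipschitz N m f L"
    and psi_pcc: "i < N \<Longrightarrow> proper_closed_convex (m i) (\<psi> i)"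
    and minimizers_nonempty: "minimizers n F \<noteq> {}"
    and L_pos: "i < N \<Longrightarrow> L i > 0"
  using composite
  by (auto simp: composite_problem_def cont_differentiable_def blockwise_Lipschitz_def)

lemma psi_not_MInfty: "i < N \<Longrightarrow> \<psi> i (UT m i x) \<noteq> -\<infinity>"
  using psi_pcc[of i] UT_in_Rn[of m i x] by (simp add: proper_closed_convex_def)

lemma dom_iff: "x \<in> domF \<longleftrightarrow> x \<in> Rn n \<and> (\<forall>i<N. \<psi> i (UT m i x) \<noteq> \<infinity>)"
  by (auto simp: domF_def objective_def sum_Pinfty)

lemma dom_Rn: "x \<in> domF \<Longrightarrow> x \<in> Rn n"
  by (simp add: domF_def)

lemma psi_dom: "x \<in> domF \<Longrightarrow> i < N \<Longrightarrow> \<psi> i (UT m i x) = ereal (\<phi> i (UT m i x))"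
  using psi_not_MInfty[of i x] by (cases "\<psi> i (UT m i x)") (auto simp: dom_iff \<phi>_def)

lemma F_dom: "x \<in> domF \<Longrightarrow> F x = ereal (f x + (\<Sum>i<N. \<phi> i (UT m i x)))"
  unfolding objective_def by (simp add: psi_dom)

lemma Fmin_le: "x \<in> Rn n \<Longrightarrow> Fmin \<le> F x"
  unfolding min_value_def by (rule INF_lower)

lemma Fmin_finite:
  assumes "x \<in> domF"
  shows "\<bar>Fmin\<bar> \<noteq> \<infinity>"
proof -
  obtain b :: real where "\<forall>x\<in>Rn n. ereal b \<le> F x"
    using composite by (auto simp: composite_problem_def)
  then have "ereal b \<le> Fmin" unfolding min_value_def by (intro INF_greatest) simp
  moreover have "Fmin \<le> F x" "F x < \<infinity>" using Fmin_le assms by (auto simp: domF_def)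
  ultimately show ?thesis by (cases Fmin) auto
qed

lemma gap_nonneg:
  assumes "x \<in> domF"
  shows "gap x \<ge> 0"
  using Fmin_finite[OF assms] F_dom[OF assms] Fmin_le[OF dom_Rn[OF assms]]
  by (cases Fmin) auto

text \<open>
  The objective is lower semicontinuous, so a limit of minimizers has at most their common value.
\<close>

lemma closed_minimizers: "closed (minimizers n F)"
  unfolding closed_sequential_limits
proof (intro allI impI, elim conjE)
  fix u v assume u: "\<forall>k. u k \<in> minimizers n F" and lim: "u \<longlonglongrightarrow> v"
  have uR: "u k \<in> Rn n" for k using u by (simp add: minimizers_def)
  have v: "v \<in> Rn n" using closed_Rn uR lim by (meson closed_sequentially)
  have "(\<lambda>k. f (u k)) \<longlonglongrightarrow> f v"
    using differentiable_imp_continuous_on[OF f_diff] uR lim v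
    by (auto simp: continuous_on_sequentially comp_def)
  then have "ereal (f v) = liminf (\<lambda>k. ereal (f (u k)))"
    by (intro lim_imp_Liminf[symmetric]) auto
  moreover have "(\<Sum>i<N. \<psi> i (UT m i v)) \<le> liminf (\<lambda>k. \<Sum>i<N. \<psi> i (UT m i (u k)))"
  proof (intro sum_le_liminf_sum)
    fix i assume "i \<in> {..<N}"
    then show "\<psi> i (UT m i v) \<noteq> -\<infinity>"
      and "\<psi> i (UT m i v) \<le> liminf (\<lambda>k. \<psi> i (UT m i (u k)))"
      using psi_not_MInfty bounded_linear.tendsto[OF bounded_linear_UT lim]
      by (auto intro!: proper_closed_convex_le_liminf[OF psi_pcc] UT_in_Rn)
  qed simp
  ultimately have "F v \<le> liminf (\<lambda>k. ereal (f (u k))) + liminf (\<lambda>k. \<Sum>i<N. \<psi> i (UT m i (u k)))"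
    by (simp add: objective_def add_left_mono)
  also have "\<dots> \<le> liminf (\<lambda>k. F (u k))"
    unfolding objective_def
    by (rule ereal_liminf_add_mono) (simp add: \<open>ereal (f v) = _\<close>[symmetric])
  finally have "F v \<le> liminf (\<lambda>k. F (u k))" .
  moreover have "F (u k) \<le> F y" if "y \<in> Rn n" for k y
    using u that by (auto simp: minimizers_def)
  then have "liminf (\<lambda>k. F (u k)) \<le> F y" if "y \<in> Rn n" for y
    using that by (intro order.trans[OF Liminf_le_Limsup Limsup_bounded]) (auto intro: always_eventually)
  ultimately show "v \<in> minimizers n F"
    using v order.trans unfolding minimizers_def by blast
qed

text \<open>
  The projection onto the optimal set exists, and the optimal value is finite as soon as the
  effective domain is nonempty.
\<close>

lemma nearest_minimizer_in_dom:
  assumes "x \<in> domF"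
  shows "nearest (minimizers n F) y \<in> domF"
proof -
  have P: "nearest (minimizers n F) y \<in> minimizers n F"
    by (rule nearest_in[OF closed_minimizers _ minimizers_nonempty]) (auto simp: minimizers_def)
  then have "nearest (minimizers n F) y \<in> Rn n" by (simp add: minimizers_def)
  moreover have "F (nearest (minimizers n F) y) \<le> F x" "F x < \<infinity>"
    using P assms by (auto simp: minimizers_def domF_def)
  ultimately show ?thesis
    unfolding domF_def using order.strict_trans1 by blast
qed

lemma Q_dom:
  assumes "x \<in> domF" "i < N"
  shows "Q N m f \<psi> L x i h =
    \<psi> i (UT m i x + h)
      + ereal (UT m i (grad n f x) \<bullet> h + 1 / 2 * L i * (norm h)\<^sup>2 - \<phi> i (UT m i x))"
  unfolding Q_def psi_dom[OF assms] by (cases "\<psi> i (UT m i x + h)") auto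

lemma Q_zero: "x \<in> domF \<Longrightarrow> i < N \<Longrightarrow> Q N m f \<psi> L x i 0 = 0"
  by (simp add: Q_dom psi_dom zero_ereal_def)

text \<open>
  A block step changes the nonsmooth part in one summand only, and the descent lemma bounds the change
  of the smooth part, so the model \<open>Q\<close> majorizes the change of the objective. The bound \<open>q\<close> is real so
  that the step is seen to stay in the effective domain.
\<close>

lemma objective_le_model:
  assumes x: "x \<in> domF" and i: "i < N" and h: "h \<in> Rn (m i)"
    and fin: "Q N m f \<psi> L x i h \<le> ereal q"
  shows "x + U m i h \<in> domF" "gap (x + U m i h) \<le> gap x + q"
proof -
  let ?y = "x + U m i h"
  have UT_y: "UT m j ?y = (if j = i then UT m i x + h else UT m j x)" for j
    using UT_U_same[of h m i] h by (simp add: UT_add UT_U_other)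
  have "\<psi> i (UT m i ?y) \<noteq> \<infinity>"
    using fin Q_dom[OF x i, of h] by (auto simp: UT_y)
  then show y: "?y \<in> domF"
    using x U_in_Rn[OF i] by (auto simp: dom_iff UT_y Rn_closure)
  have "(\<Sum>j<N. \<phi> j (UT m j ?y) - \<phi> j (UT m j x))
      = (\<Sum>j<N. if j = i then \<phi> i (UT m i x + h) - \<phi> i (UT m i x) else 0)"
    by (rule sum.cong) (auto simp: UT_y)
  then have "(\<Sum>j<N. \<phi> j (UT m j ?y)) - (\<Sum>j<N. \<phi> j (UT m j x))
      = \<phi> i (UT m i x + h) - \<phi> i (UT m i x)"
    using i by (simp add: sum_subtractf)
  moreover have "f ?y \<le> f x + (UT m i (grad n f x) \<bullet> h + 1 / 2 * L i * (norm h)\<^sup>2)"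
    by (rule block_descent[OF f_C1 f_Lipschitz dom_Rn[OF x] i h])
  moreover have "UT m i (grad n f x) \<bullet> h + 1 / 2 * L i * (norm h)\<^sup>2
      + \<phi> i (UT m i x + h) - \<phi> i (UT m i x) \<le> q"
    using fin Q_dom[OF x i, of h] psi_dom[OF y i]
    by (cases "\<psi> i (UT m i x + h)") (auto simp: UT_y)
  ultimately show "gap ?y \<le> gap x + q"
    by (simp add: F_dom x y)
qed

text \<open>
  Since the model majorizes the change of the objective, it cannot fall below \<open>- gap x\<close>. Without
  this bound the inexactness criterion would be void: for \<open>\<eta> > 0\<close> it would read \<open>\<infinity> \<ge> \<infinity>\<close>.
\<close>

lemma Q_inf_finite:
  assumes x: "x \<in> domF" and i: "i < N"
  shows "Q_inf N m f \<psi> L x i = ereal (Qinf x i)"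
proof -
  have "ereal (- gap x) \<le> Q N m f \<psi> L x i h" if h: "h \<in> Rn (m i)" for h
  proof (rule ccontr)
    assume "\<not> ereal (- gap x) \<le> Q N m f \<psi> L x i h"
    then obtain q where q: "Q N m f \<psi> L x i h < ereal q" "ereal q < ereal (- gap x)"
      using ereal_dense2[of "Q N m f \<psi> L x i h" "ereal (- gap x)"] by (auto simp: not_le)
    then show False
      using objective_le_model[OF x i h, of q] gap_nonneg[of "x + U m i h"] by (simp add: order.strict_implies_order)
  qed
  then have "ereal (- gap x) \<le> Q_inf N m f \<psi> L x i"
    unfolding Q_inf_def by (intro INF_greatest)
  moreover have "Q_inf N m f \<psi> L x i \<le> 0"
    unfolding Q_inf_def
    by (rule INF_lower2[of 0]) (auto simp: Q_zero x i Rn_closure)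
  ultimately show ?thesis by (cases "Q_inf N m f \<psi> L x i") (auto simp: Qinf_def)
qed

text \<open>
  As \<open>Q\<close> vanishes at \<open>0\<close>, the criterion says that the step attains the fraction \<open>1 - \<eta>\<close> of the best
  possible model decrease.
\<close>

lemma inexact_step_decrease:
  assumes x: "x \<in> domF" and i: "i < N" and h: "h \<in> Rn (m i)"
    and crit: "ereal \<eta> * (Q N m f \<psi> L x i 0 - Q_inf N m f \<psi> L x i)
       \<ge> Q N m f \<psi> L x i h - Q_inf N m f \<psi> L x i"
  shows "x + U m i h \<in> domF" "gap (x + U m i h) \<le> gap x + (1 - \<eta>) * Qinf x i"
proof -
  have "Q N m f \<psi> L x i h \<le> ereal ((1 - \<eta>) * Qinf x i)"
    using crit unfolding Q_zero[OF x i] Q_inf_finite[OF x i]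
    by (cases "Q N m f \<psi> L x i h") (auto simp: algebra_simps)
  then show "x + U m i h \<in> domF" "gap (x + U m i h) \<le> gap x + (1 - \<eta>) * Qinf x i"
    using objective_le_model[OF x i h] by blast+
qed

text \<open>
  The trial step is the fraction \<open>l\<close> of the way, in block \<open>i\<close>, from \<open>x\<close> to \<open>y\<close>. The fraction is free
  to differ from block to block, which is what lets one argument serve all sampling distributions.
\<close>

lemma Qinf_le:
  assumes x: "x \<in> domF" and y: "y \<in> domF" and i: "i < N" and l: "0 \<le> l" "l \<le> 1"
  shows "Qinf x i \<le> l * (UT m i (grad n f x) \<bullet> UT m i (y - x)
      + \<phi> i (UT m i y) - \<phi> i (UT m i x)) + l\<^sup>2 * L i / 2 * (norm (UT m i (y - x)))\<^sup>2"
proof -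
  let ?u = "UT m i x" and ?v = "UT m i y"
  let ?h = "l *\<^sub>R (?v - ?u)"
  obtain c where c: "\<psi> i (?u + ?h) = ereal c" "c \<le> \<phi> i ?u + l * (\<phi> i ?v - \<phi> i ?u)"
    using proper_closed_convex_segment[OF psi_pcc[OF i] UT_in_Rn UT_in_Rn psi_dom[OF x i] psi_dom[OF y i] l]
    by metis
  have "Q_inf N m f \<psi> L x i \<le> Q N m f \<psi> L x i ?h"
    unfolding Q_inf_def by (intro INF_lower Rn_closure UT_in_Rn)
  then have "Qinf x i \<le> c + (UT m i (grad n f x) \<bullet> ?h + 1 / 2 * L i * (norm ?h)\<^sup>2 - \<phi> i ?u)"
    unfolding Q_dom[OF x i] Q_inf_finite[OF x i] c(1) by simp
  also have "\<dots> \<le> \<phi> i ?u + l * (\<phi> i ?v - \<phi> i ?u)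
      + (UT m i (grad n f x) \<bullet> ?h + 1 / 2 * L i * (norm ?h)\<^sup>2 - \<phi> i ?u)"
    using c(2) by simp
  also have "(norm ?h)\<^sup>2 = l\<^sup>2 * (norm (?v - ?u))\<^sup>2"
    by (simp only: norm_scaleR power_mult_distrib power2_abs)
  finally show ?thesis
    by (simp add: UT_diff algebra_simps)
qed

text \<open>
  Let \<open>y\<close> be the midpoint of \<open>x\<close> and its projection \<open>P\<close> onto the optimal set, and let block \<open>i\<close> try the
  fraction \<open>t / p i\<close> of the way to \<open>y\<close>. The factors \<open>p i\<close> and \<open>t / p i\<close> multiply to the constant \<open>t\<close>, so
  the weighted first-order terms sum to \<open>t\<close> times the directional derivative of \<open>f\<close> plus \<open>t\<close> times the change
  of the nonsmooth part; convexity of \<open>f\<close> bounds this by \<open>t * (F y - F x)\<close>. The hypothesis on \<open>t\<close> bounds the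
  curvature \<open>t / p i * L i\<close> of every block by \<open>\<mu>\<close>, so the quadratic terms sum to at most
  \<open>t * \<mu> / 2 * (norm (y - x))\<^sup>2\<close>. Strong convexity on the optimal set, used at the midpoint, gains
  exactly this amount over the halving of the gap.
\<close>

lemma expected_model_decrease:
  assumes x: "x \<in> domF" and \<mu>: "optimal_set_strongly_convex n F \<mu>"
    and \<mu>_le: "\<And>i. i < N \<Longrightarrow> \<mu> \<le> L i"
    and t: "0 < t" "\<And>i. i < N \<Longrightarrow> t * L i \<le> \<mu> * p i" and p: "\<And>i. i < N \<Longrightarrow> 0 < p i"
  shows "(\<Sum>i<N. p i * Qinf x i) \<le> - (t / 2) * gap x"
proof -
  define P where "P = nearest (minimizers n F) x"
  define y where "y = (1/2) *\<^sub>R x + (1 - 1/2) *\<^sub>R P"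
  define d where "d = y - x"
  have P: "P \<in> Rn n"
    unfolding P_def by (intro dom_Rn nearest_minimizer_in_dom[OF x])
  have yR: "y \<in> Rn n" and dR: "d \<in> Rn n"
    unfolding y_def d_def by (intro Rn_closure P dom_Rn[OF x])+
  \<comment> \<open>The quadratic term of the strong convexity inequality becomes \<open>\<mu> / 2 * (norm d)\<^sup>2\<close>.\<close>
  have d_P: "norm (x - P) = 2 * norm d"
  proof -
    have "x - P = (-2) *\<^sub>R d"
      by (rule evec_eqI) (simp add: d_def y_def)
    then show ?thesis by (simp only: norm_scaleR)
  qed
  have "F y \<le> ereal (1/2) * F x + ereal (1 - 1/2) * Fmin
      - ereal (1 / 2 * \<mu> * (1/2) * (1 - 1/2) * (norm (x - P))\<^sup>2)"
    using bspec[OF bspec[OF \<mu>[unfolded optimal_set_strongly_convex_def Let_def] dom_Rn[OF x]], of "1/2"]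
    unfolding P_def y_def by simp
  also have "\<dots> = Fmin + ereal (gap x / 2 - \<mu> / 2 * (norm d)\<^sup>2)"
    unfolding d_P using Fmin_finite[OF x] F_dom[OF x]
    by (cases Fmin) (auto simp: power_mult_distrib field_simps)
  finally have Fy: "F y \<le> Fmin + ereal (gap x / 2 - \<mu> / 2 * (norm d)\<^sup>2)" .
  then have y: "y \<in> domF"
    using yR Fmin_finite[OF x] by (cases Fmin) (auto simp: domF_def)
  have gap_y: "gap y \<le> gap x / 2 - \<mu> / 2 * (norm d)\<^sup>2"
    using Fy F_dom[OF y] Fmin_finite[OF x] by (cases Fmin) auto
  have "p i * Qinf x i \<le> t * (UT m i (grad n f x) \<bullet> UT m i d
      + \<phi> i (UT m i y) - \<phi> i (UT m i x) + \<mu> / 2 * (norm (UT m i d))\<^sup>2)" if i: "i < N" for i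
  proof -
    define l where "l = t / p i"
    have pl: "p i * l = t" using p[OF i] by (simp add: l_def)
    have lL: "l * L i \<le> \<mu>" using t(2)[OF i] p[OF i] by (simp add: l_def field_simps)
    have l: "0 \<le> l" using t p[OF i] by (simp add: l_def)
    have "l * L i \<le> 1 * L i" using lL \<mu>_le[OF i] by simp
    \<comment> \<open>This needs \<open>\<mu> \<le> L i\<close>: the trial step must not pass \<open>y\<close>, or convexity of \<open>\<psi> i\<close> says nothing.\<close>
    then have "l \<le> 1" using L_pos[OF i] by (simp only: mult_le_cancel_right_pos)
    from Qinf_le[OF x y i l this] have "p i * Qinf x i \<le> p i * (l * (UT m i (grad n f x) \<bullet> UT m i d
      + \<phi> i (UT m i y) - \<phi> i (UT m i x)) + l\<^sup>2 * L i / 2 * (norm (UT m i d))\<^sup>2)"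
      unfolding d_def using p[OF i] by (intro mult_left_mono) auto
    also have "\<dots> = (p i * l) * (UT m i (grad n f x) \<bullet> UT m i d
      + \<phi> i (UT m i y) - \<phi> i (UT m i x) + (l * L i) / 2 * (norm (UT m i d))\<^sup>2)"
      by (simp add: algebra_simps power2_eq_square)
    also have "\<dots> \<le> t * (UT m i (grad n f x) \<bullet> UT m i d
      + \<phi> i (UT m i y) - \<phi> i (UT m i x) + \<mu> / 2 * (norm (UT m i d))\<^sup>2)"
      unfolding pl using t(1) lL by (intro mult_left_mono add_left_mono mult_right_mono) auto
    finally show ?thesis .
  qed
  then have "(\<Sum>i<N. p i * Qinf x i) \<le> (\<Sum>i<N. t * (UT m i (grad n f x) \<bullet> UT m i d
      + \<phi> i (UT m i y) - \<phi> i (UT m i x) + \<mu> / 2 * (norm (UT m i d))\<^sup>2))"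
    by (intro sum_mono) auto
  also have "\<dots> = t * (grad n f x \<bullet> d + (\<Sum>i<N. \<phi> i (UT m i y)) - (\<Sum>i<N. \<phi> i (UT m i x))
      + \<mu> / 2 * (norm d)\<^sup>2)"
    unfolding sum_distrib_left[symmetric] sum.distrib sum_subtractf
    by (simp add: inner_blocks[OF dR, of "grad n f x"] inner_commute[of "grad n f x"]
        power2_norm_eq_inner inner_blocks[OF dR, of d] inner_commute)
  also have "\<dots> \<le> t * (gap y - gap x + \<mu> / 2 * (norm d)\<^sup>2)"
    using convex_above_tangent[OF f_diff f_convex dom_Rn[OF x] dR] t(1)
    by (intro mult_left_mono) (auto simp: F_dom x y d_def)
  also have "\<dots> \<le> t * (- (gap x / 2))"
  proof (rule mult_left_mono)
    have "a - b + c \<le> - (b / 2)" if "a \<le> b / 2 - c" for a b c :: real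
      using that by simp
    then show "gap y - gap x + \<mu> / 2 * (norm d)\<^sup>2 \<le> - (gap x / 2)"
      using gap_y by blast
  qed (use t(1) in simp)
  finally show ?thesis by simp
qed

end

section \<open>Expected decrease along a run\<close>

lemma finite_history: "(\<And>k. finite (set_pmf (p k))) \<Longrightarrow> finite (set_pmf (history_pmf p k))"
  by (induction k) auto

lemma set_history:
  assumes "\<And>k. set_pmf (p k) = A" "h \<in> set_pmf (history_pmf p k)"
  shows "set h \<subseteq> A"
  using assms(2)
proof (induction k arbitrary: h)
  case (Suc k)
  then obtain h' i where "h = h' @ [i]" "h' \<in> set_pmf (history_pmf p k)" "i \<in> A"
    using assms(1) by auto
  then show ?case using Suc.IH[of h'] by simp
qed simp

lemma expectation_history_Suc:
  fixes g :: "nat list \<Rightarrow> real"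
  assumes supp: "\<And>k. set_pmf (p k) = A" and "finite A"
  shows "measure_pmf.expectation (history_pmf p (Suc k)) g =
    (\<Sum>h\<in>set_pmf (history_pmf p k). pmf (history_pmf p k) h * (\<Sum>i\<in>A. pmf (p k) i * g (h @ [i])))"
proof -
  have fin: "finite (set_pmf (p k))" for k using assms by simp
  have "measure_pmf.expectation (p k) (\<lambda>i. g (h @ [i])) = (\<Sum>i\<in>A. pmf (p k) i * g (h @ [i]))" for h
    using integral_measure_pmf[OF \<open>finite A\<close>, of "p k" "\<lambda>i. g (h @ [i])"] supp by simp
  then show ?thesis
    using fin by (simp add: pmf_expectation_bind[OF finite_history[of p k, OF fin]])
qed

context convex_composite
begin

lemma iterates_in_dom:
  assumes run: "inexact_rbcd N m f \<psi> L \<eta> p x d" and h: "set h \<subseteq> {..<N}"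
  shows "x h \<in> domF"
  using h
proof (induction h rule: rev_induct)
  case Nil
  then show ?case using run by (auto simp: inexact_rbcd_def domF_def)
next
  case (snoc i h)
  then have "x h \<in> domF" "i < N" "set h \<subseteq> {..<N}" by auto
  then show ?case
    using run inexact_step_decrease(1)[of "x h" i "d h i" \<eta>] by (simp add: inexact_rbcd_def)
qed

text \<open>
  All iterates reachable with positive probability lie in the effective domain, so the expectation of the
  extended-valued objective is an ordinary expectation.
\<close>

lemma expected_gap_eq:
  assumes run: "inexact_rbcd N m f \<psi> L \<eta> p x d"
  shows "expected_gap N m f \<psi> p x k
    = ereal (measure_pmf.expectation (history_pmf p k) (\<lambda>h. gap (x h)))"
proof -
  let ?M = "history_pmf p k"
  have supp: "\<And>k. set_pmf (p k) = {..<N}" using run by (simp add: inexact_rbcd_def)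
  have fin: "finite (set_pmf ?M)" by (rule finite_history) (simp add: supp)
  have x_dom: "x h \<in> domF" if "h \<in> set_pmf ?M" for h
    using iterates_in_dom[OF run] set_history[OF supp that] by blast
  have Fmin: "\<bar>Fmin\<bar> \<noteq> \<infinity>" using Fmin_finite[OF iterates_in_dom[OF run, of "[]"]] by simp
  have F_real: "ereal (pmf ?M h) * F (x h)
      = ereal (pmf ?M h * (real_of_ereal Fmin + gap (x h)))" if "h \<in> set_pmf ?M" for h
    using F_dom[OF x_dom[OF that]] by simp
  have "ereal_expectation ?M (\<lambda>h. F (x h))
      = (\<Sum>h\<in>set_pmf ?M. ereal (pmf ?M h * (real_of_ereal Fmin + gap (x h))))"
    unfolding ereal_expectation_def by (intro sum.cong refl F_real)
  also have "\<dots> = ereal (\<Sum>h\<in>set_pmf ?M. pmf ?M h * (real_of_ereal Fmin + gap (x h)))"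
    by simp
  also have "(\<Sum>h\<in>set_pmf ?M. pmf ?M h * (real_of_ereal Fmin + gap (x h)))
      = real_of_ereal Fmin + (\<Sum>h\<in>set_pmf ?M. pmf ?M h * gap (x h))"
    using sum_pmf_eq_1[OF fin subset_refl]
    by (simp only: distrib_left sum.distrib sum_distrib_right[symmetric] mult_1)
  also have "(\<Sum>h\<in>set_pmf ?M. pmf ?M h * gap (x h)) = measure_pmf.expectation ?M (\<lambda>h. gap (x h))"
    using integral_measure_pmf[OF fin, of ?M "\<lambda>h. gap (x h)"] by simp
  finally show ?thesis
    unfolding expected_gap_def using Fmin by (cases Fmin) auto
qed

text \<open>
  Conditioning on the history before the last sampled block gives the one-step contraction by
  \<open>1 - (1 - \<eta>) * t / 2\<close>, which is iterated.
\<close>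

lemma expected_gap_geometric:
  assumes run: "inexact_rbcd N m f \<psi> L \<eta> p x d" and \<eta>: "0 \<le> \<eta>" "\<eta> < 1"
    and \<mu>: "optimal_set_strongly_convex n F \<mu>" "\<And>i. i < N \<Longrightarrow> \<mu> \<le> L i"
    and t: "0 < t" "\<And>k i. i < N \<Longrightarrow> t * L i \<le> \<mu> * pmf (p k) i"
  defines "c \<equiv> (1 - \<eta>) * t / 2"
  shows "0 < c" "c \<le> 1" "0 \<le> gap (x [])"
    and "expected_gap N m f \<psi> p x k \<le> ereal ((1 - c) ^ k * gap (x []))"
proof -
  let ?E = "\<lambda>k. measure_pmf.expectation (history_pmf p k) (\<lambda>h. gap (x h))"
  have supp: "\<And>k. set_pmf (p k) = {..<N}" using run by (simp add: inexact_rbcd_def)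
  have p_pos: "0 < pmf (p k) i" if "i < N" for k i
    using supp that by (simp add: pmf_positive_iff)
  have N: "0 < N" using composite by (simp add: composite_problem_def)
  show "0 < c" using \<eta> t(1) by (simp add: c_def)
  \<comment> \<open>Any single block shows \<open>t \<le> 1\<close>, which makes the contraction factor nonnegative.\<close>
  have "t * L 0 \<le> L 0 * 1"
    by (rule order.trans[OF t(2)[OF N, of 0] mult_mono[OF \<mu>(2)[OF N] pmf_le_1]])
       (use L_pos[OF N] in \<open>auto simp: pmf_nonneg less_imp_le\<close>)
  then have "t \<le> 1"
    unfolding mult.commute[of t] using L_pos[OF N] by (simp only: mult_le_cancel_left_pos)
  then have "(1 - \<eta>) * t \<le> 1 * 1" using \<eta> t(1) by (intro mult_mono) auto
  then show c1: "c \<le> 1" by (simp add: c_def)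
  show "0 \<le> gap (x [])" using gap_nonneg[OF iterates_in_dom[OF run, of "[]"]] by simp
  have E_Suc: "?E (Suc k) \<le> (1 - c) * ?E k" for k
  proof -
    let ?M = "history_pmf p k"
    have fin: "finite (set_pmf ?M)" by (rule finite_history) (simp add: supp)
    have step: "(\<Sum>i<N. pmf (p k) i * gap (x (h @ [i]))) \<le> (1 - c) * gap (x h)"
      if "h \<in> set_pmf ?M" for h
    proof -
      have h: "set h \<subseteq> {..<N}" by (rule set_history[OF supp that])
      have xh: "x h \<in> domF" by (rule iterates_in_dom[OF run h])
      have "(\<Sum>i<N. pmf (p k) i * gap (x (h @ [i])))
          \<le> (\<Sum>i<N. pmf (p k) i * (gap (x h) + (1 - \<eta>) * Qinf (x h) i))"
      proof (intro sum_mono mult_left_mono pmf_nonneg)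
        fix i assume "i \<in> {..<N}"
        then show "gap (x (h @ [i])) \<le> gap (x h) + (1 - \<eta>) * Qinf (x h) i"
          using run h inexact_step_decrease(2)[OF xh, of i "d h i" \<eta>]
          by (simp add: inexact_rbcd_def)
      qed
      also have "\<dots> = (\<Sum>i<N. pmf (p k) i) * gap (x h)
          + (1 - \<eta>) * (\<Sum>i<N. pmf (p k) i * Qinf (x h) i)"
        by (simp add: distrib_left sum.distrib sum_distrib_right sum_distrib_left mult_ac)
      also have "\<dots> \<le> 1 * gap (x h) + (1 - \<eta>) * (- (t / 2) * gap (x h))"
        using expected_model_decrease[OF xh \<mu> t(1) t(2)[of _ k] p_pos] \<eta> supp
        by (intro add_mono mult_left_mono) (simp_all add: sum_pmf_eq_1)
      finally show ?thesis by (simp add: c_def algebra_simps)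
    qed
    have "?E (Suc k) = (\<Sum>h\<in>set_pmf ?M. pmf ?M h * (\<Sum>i<N. pmf (p k) i * gap (x (h @ [i]))))"
      by (rule expectation_history_Suc[OF supp]) simp
    also have "\<dots> \<le> (\<Sum>h\<in>set_pmf ?M. pmf ?M h * ((1 - c) * gap (x h)))"
      by (intro sum_mono mult_left_mono step pmf_nonneg)
    also have "\<dots> = (1 - c) * (\<Sum>h\<in>set_pmf ?M. pmf ?M h * gap (x h))"
      by (simp add: sum_distrib_left mult_ac)
    also have "(\<Sum>h\<in>set_pmf ?M. pmf ?M h * gap (x h)) = ?E k"
      using integral_measure_pmf[OF fin, of ?M "\<lambda>h. gap (x h)"] by simp
    finally show ?thesis .
  qed
  have "?E k \<le> (1 - c) ^ k * gap (x [])"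
  proof (induction k)
    case (Suc k)
    have "?E (Suc k) \<le> (1 - c) * ?E k" by (rule E_Suc)
    also have "\<dots> \<le> (1 - c) * ((1 - c) ^ k * gap (x []))"
      using Suc c1 by (intro mult_left_mono) auto
    finally show ?case by (simp only: power_Suc mult.assoc)
  qed simp
  then show "expected_gap N m f \<psi> p x k \<le> ereal ((1 - c) ^ k * gap (x []))"
    by (simp add: expected_gap_eq[OF run])
qed

end

section \<open>From a geometric rate to the iteration complexity\<close>

text \<open>
  Since \<open>1 - c \<le> exp (- c)\<close>, it suffices to round \<open>ln ((\<Delta> + 1) / \<epsilon>) / c\<close> up to an integer. The
  constant 6 counts three terms, each at most \<open>ln (1 / \<epsilon>) / c = 2 * B * ln (1 / \<epsilon>)\<close> when
  \<open>\<epsilon> < 1 / (3 + \<Delta>)\<close>: the main term, \<open>ln (\<Delta> + 1) / c\<close>, and the 1 lost in rounding.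
\<close>

lemma complexity_within_geometric:
  assumes c: "0 < c" "c \<le> 1" "1 / c = 2 * B" and \<Delta>: "0 \<le> \<Delta>"
    and rate: "\<And>k. gap k \<le> ereal ((1 - c) ^ k * \<Delta>)"
  shows "complexity_within 6 (1 / (3 + \<Delta>)) (\<lambda>\<epsilon>. B * ln (1 / \<epsilon>)) gap"
proof -
  \<comment> \<open>\<open>\<Delta> + 1\<close> replaces \<open>\<Delta>\<close> to keep the argument of the logarithm positive when the initial gap is \<open>0\<close>.\<close>
  define K where "K = (\<lambda>\<epsilon>. nat \<lceil>ln ((\<Delta> + 1) / \<epsilon>) / c\<rceil>)"
  have "gap k \<le> ereal \<epsilon>" if \<epsilon>: "0 < \<epsilon>" and k: "K \<epsilon> \<le> k" for \<epsilon> k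
  proof -
    have "ln ((\<Delta> + 1) / \<epsilon>) / c \<le> real k"
      using k unfolding K_def by (simp add: nat_le_iff ceiling_le_iff)
    then have ck: "ln ((\<Delta> + 1) / \<epsilon>) \<le> real k * c"
      using c(1) by (simp add: field_simps)
    have "(1 - c) ^ k \<le> exp (- c) ^ k"
      using c(2) exp_ge_add_one_self[of "- c"] by (intro power_mono) auto
    also have "\<dots> = exp (- (real k * c))"
      by (simp add: exp_of_nat_mult[symmetric])
    also have "\<dots> \<le> exp (- ln ((\<Delta> + 1) / \<epsilon>))" using ck by simp
    also have "\<dots> = \<epsilon> / (\<Delta> + 1)" using \<epsilon> \<Delta> by (simp add: exp_minus)
    finally have "(1 - c) ^ k * \<Delta> \<le> \<epsilon> / (\<Delta> + 1) * \<Delta>" using \<Delta> by (intro mult_right_mono)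
    also have "\<dots> \<le> \<epsilon>" using \<epsilon> \<Delta> by (simp add: field_simps)
    finally show ?thesis using rate[of k] order.trans ereal_less_eq(3) by blast
  qed
  moreover have "real (K \<epsilon>) \<le> 6 * (B * ln (1 / \<epsilon>))" if \<epsilon>: "0 < \<epsilon>" "\<epsilon> < 1 / (3 + \<Delta>)" for \<epsilon>
  proof -
    let ?l = "ln (1 / \<epsilon>)"
    have e: "3 + \<Delta> < 1 / \<epsilon>" using \<epsilon> \<Delta> by (simp add: field_simps)
    \<comment> \<open>The \<open>3\<close> in the bound on \<open>\<epsilon>\<close> is there to exceed \<open>exp 1\<close>.\<close>
    have "exp 1 \<le> 1 / \<epsilon>" using e exp_le \<Delta> by linarith
    then have l1: "1 \<le> ?l" using \<epsilon>(1) by (simp add: ln_ge_iff)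
    have "ln ((\<Delta> + 1) / \<epsilon>) = ln (\<Delta> + 1) + ?l"
      using \<epsilon>(1) \<Delta> by (simp add: ln_div)
    also have "ln (\<Delta> + 1) \<le> ?l" using e \<epsilon>(1) \<Delta> by (subst ln_le_cancel_iff) auto
    finally have up: "ln ((\<Delta> + 1) / \<epsilon>) \<le> 2 * ?l" by simp
    have "0 \<le> ln ((\<Delta> + 1) / \<epsilon>)"
      using l1 \<open>ln ((\<Delta> + 1) / \<epsilon>) = ln (\<Delta> + 1) + ?l\<close> \<Delta> by simp
    then have "real (K \<epsilon>) \<le> ln ((\<Delta> + 1) / \<epsilon>) / c + 1"
      unfolding K_def using c(1) by (simp add: of_nat_nat)
    also have "\<dots> \<le> (2 * ?l) / c + ?l / c"
    proof (intro add_mono divide_right_mono up)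
      show "1 \<le> ?l / c" using l1 c by (simp add: field_simps)
    qed (use c(1) in simp)
    also have "\<dots> = 3 * (1 / c) * ?l" by simp
    also have "\<dots> = 6 * (B * ?l)" unfolding c(3) by simp
    finally show ?thesis .
  qed
  ultimately show ?thesis unfolding complexity_within_def by blast
qed

context convex_composite
begin

text \<open>
  Here \<open>t = \<mu> / S\<close>. The smallest possible \<open>S\<close> is \<open>N * L_max\<close> for uniform sampling and \<open>N * L_avg\<close>,
  the sum of the \<open>L i\<close>, for probabilities proportional to the \<open>L i\<close>.
\<close>

lemma complexity_of_run:
  assumes run: "inexact_rbcd N m f \<psi> L \<eta> p x d" and \<eta>: "0 \<le> \<eta>" "\<eta> < 1"
    and \<mu>: "optimal_set_strongly_convex n F \<mu>" "\<mu> \<le> L_min N L" "0 < \<mu>"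
    and S: "0 < S" "\<And>k i. i < N \<Longrightarrow> L i \<le> S * pmf (p k) i"
    and \<Delta>: "F (x []) - Fmin = ereal \<Delta>"
  shows "complexity_within 6 (1 / (3 + \<bar>\<Delta>\<bar>)) (\<lambda>\<epsilon>. S / ((1 - \<eta>) * \<mu>) * ln (1 / \<epsilon>))
    (expected_gap N m f \<psi> p x)"
proof -
  let ?t = "\<mu> / S"
  have \<mu>_le: "\<mu> \<le> L i" if "i < N" for i
    by (rule order.trans[OF \<mu>(2)[unfolded L_min_def] Min_le]) (use that in auto)
  have t: "?t * L i \<le> \<mu> * pmf (p k) i" if "i < N" for i k
    using mult_left_mono[OF S(2)[OF that], of "\<mu>" k] S(1) \<mu>(3) by (simp add: field_simps)
  have "0 < ?t" using S \<mu> by simp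
  note geo = expected_gap_geometric[OF run \<eta> \<mu>(1) \<mu>_le this t]
  have gap0: "gap (x []) = \<Delta>"
    using \<Delta> Fmin_finite[OF iterates_in_dom[OF run, of "[]"]]
    by (cases Fmin; cases "F (x [])") auto
  have "complexity_within 6 (1 / (3 + gap (x []))) (\<lambda>\<epsilon>. S / ((1 - \<eta>) * \<mu>) * ln (1 / \<epsilon>))
      (expected_gap N m f \<psi> p x)"
    by (rule complexity_within_geometric[OF geo(1,2) _ geo(3,4)]) simp_all
  then show ?thesis using geo(3) by (simp only: gap0 abs_of_nonneg)
qed

end

theorem corollary3:
  fixes \<Delta> :: real
  shows
    "\<exists>C>0. \<exists>\<epsilon>0>0.
       \<forall>(N::nat) (m::nat \<Rightarrow> nat) (f::evec \<Rightarrow> real) (\<psi>::nat \<Rightarrow> evec \<Rightarrow> ereal)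
        (L::nat \<Rightarrow> real) (\<mu>::real) (\<eta>::real)
        (p::nat \<Rightarrow> nat pmf) (x::nat list \<Rightarrow> evec) (d::nat list \<Rightarrow> nat \<Rightarrow> evec).
         composite_problem N m f \<psi> L \<and>
         convex_on (Rn (offset m N)) f \<and>
         0 < \<mu> \<and> \<mu> \<le> L_min N L \<and>
         optimal_set_strongly_convex (offset m N) (objective N m f \<psi>) \<mu> \<and>
         0 \<le> \<eta> \<and> \<eta> < 1 \<and>
         inexact_rbcd N m f \<psi> L \<eta> p x d \<and>
         objective N m f \<psi> (x []) - min_value (offset m N) (objective N m f \<psi>) = ereal \<Delta>
         \<longrightarrow>
         ((\<forall>k. \<forall>i<N. pmf (p k) i = 1 / real N) \<longrightarrow>
            complexity_within C \<epsilon>0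
              (\<lambda>\<epsilon>. real N * L_max N L / ((1 - \<eta>) * \<mu>) * ln (1 / \<epsilon>))
              (expected_gap N m f \<psi> p x)) \<and>
         ((\<forall>k. \<forall>i<N. pmf (p k) i = L i / (real N * L_avg N L)) \<longrightarrow>
            complexity_within C \<epsilon>0
              (\<lambda>\<epsilon>. real N * L_avg N L / ((1 - \<eta>) * \<mu>) * ln (1 / \<epsilon>))
              (expected_gap N m f \<psi> p x))"
proof (rule exI[of _ 6], rule conjI, simp, rule exI[of _ "1 / (3 + \<bar>\<Delta>\<bar>)"], rule conjI, simp add: add_pos_nonneg,
    intro allI impI, elim conjE)
  fix N m f \<psi> L \<mu> \<eta> p x d
  assume problem: "composite_problem N m f \<psi> L" "convex_on (Rn (offset m N)) f"
    and \<mu>: "0 < \<mu>" "\<mu> \<le> L_min N L"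
      "optimal_set_strongly_convex (offset m N) (objective N m f \<psi>) \<mu>"
    and \<eta>: "0 \<le> \<eta>" "\<eta> < 1"
    and run: "inexact_rbcd N m f \<psi> L \<eta> p x d"
    and \<Delta>: "objective N m f \<psi> (x []) - min_value (offset m N) (objective N m f \<psi>) = ereal \<Delta>"
  interpret convex_composite N m f \<psi> L
    using problem by unfold_locales
  note complexity = complexity_of_run[OF run \<eta> \<mu>(3,2,1) _ _ \<Delta>]
  have N: "0 < N" using problem(1) by (simp add: composite_problem_def)
  have L_le_max: "L i \<le> L_max N L" if "i < N" for i
    unfolding L_max_def using that by (intro Max_ge) auto
  then have "0 < L_max N L" using L_pos[OF N] N by fastforce
  moreover have "0 < (\<Sum>i<N. L i)" using L_pos N by (intro sum_pos) auto
  ultimately show "((\<forall>k. \<forall>i<N. pmf (p k) i = 1 / real N) \<longrightarrow>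
            complexity_within 6 (1 / (3 + \<bar>\<Delta>\<bar>))
              (\<lambda>\<epsilon>. real N * L_max N L / ((1 - \<eta>) * \<mu>) * ln (1 / \<epsilon>))
              (expected_gap N m f \<psi> p x)) \<and>
         ((\<forall>k. \<forall>i<N. pmf (p k) i = L i / (real N * L_avg N L)) \<longrightarrow>
            complexity_within 6 (1 / (3 + \<bar>\<Delta>\<bar>))
              (\<lambda>\<epsilon>. real N * L_avg N L / ((1 - \<eta>) * \<mu>) * ln (1 / \<epsilon>))
              (expected_gap N m f \<psi> p x))"
    using N L_le_max by (intro conjI impI complexity) (simp_all add: L_avg_def)
qed

end
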